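(* Let $X,Y,Z$ be finite sets and let $T\subseteq X\times Y\times Z$ be a nonempty relation such that for every $(x,y)\in X\times Y$ there exists $z\in Z$ with $(x,y,z)\in T$. Then the optimal objective value of the integer program $\mathbf{PN}(T)$ (defined in the context) equals the protocol partition number $C^P(T)$ of $M_T$.
   Context: Let $T$ be as in the claim. The communication matrix $M_T$ has rows indexed by $X$ and columns by $Y$; its cell set is $C_T=X\times Y$. A rectangle is a nonempty product $X'\times Y'\subseteq X\times Y$ (with $X',Y'$ nonempty); $\mathcal{R}(T)$ denotes the set of all rectangles and $\mathcal{R}^{\ast}(T)=\mathcal{R}(T)\setminus\{C_T\}$. A rectangle $X'\times Y'$ is monochromatic if there is $z\in Z$ with $(x,y,z)\in T$ for all $(x,y)\in X'\times Y'$; $\mathcal{M}(T)$ denotes the set of monochromatic rectangles. A partition of a rectangle $X'\times Y'$ is an unordered pair of rectangles $\{X'_1\times Y',X'_2\times Y'\}$ with $X'=X'_1\cup X'_2$, $X'_1\cap X'_2=\emptyset$, or $\{X'\times Y'_1,X'\times Y'_2\}$ with $Y'=Y'_1\cup Y'_2$, $Y'_1\cap Y'_2=\emptyset$; $\mathcal{P}(R)$ is the set of partitions of $R$, and for $P\in\mathcal{P}(R)$ we write $V\in P$ if $V$ is one of the two rectangles of $P$. Let $\Gamma(T)=\{(R,P): R\in\mathcal{R}(T),\ P\in\mathcal{P}(R)\}$. A set $\mathcal{R}$ of pairwise disjoint rectangles recursively partitions $M_T$ if its union is $C_T$ and there is a rooted binary tree whose vertices correspond to rectangles, whose root corresponds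 to $C_T$, whose leaves correspond exactly to the rectangles of $\mathcal{R}$, and such that for each non-leaf vertex the rectangles of its two children form a partition of the rectangle of that vertex. The protocol partition number $C^P(T)$ is the minimum size of a set of pairwise disjoint monochromatic rectangles that recursively partitions $M_T$. The integer program $\mathbf{PN}(T)$ has variables $x\in\mathbb{N}^{\mathcal{M}(T)}$, $y\in\mathbb{N}^{\Gamma(T)}$ ($\mathbb{N}$ the nonnegative integers) and asks to minimize $\sum_{R\in\mathcal{M}(T)}x_R$ subject to (i) $\sum_{R\in\mathcal{M}(T):\,c\in R}x_R=1$ for every $c\in C_T$, and (ii) for every $R\in\mathcal{R}^{\ast}(T)$: $\sum_{V\in\mathcal{R}(T)}\sum_{P\in\mathcal{P}(V):\,R\in P}y_{V,P}=\sum_{P\in\mathcal{P}(R)}y_{R,P}+x_R$ if $R\in\mathcal{M}(T)$, and $=\sum_{P\in\mathcal{P}(R)}y_{R,P}$ otherwise. *)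

theory Defs
  imports "HOL-Library.FuncSet" "HOL-Library.Disjoint_Sets"
begin

text \<open>
  A rectangle is represented by its set of cells. Both sides being nonempty, the sides are
  determined by that set.
\<close>

definition rectangles :: "'a set \<Rightarrow> 'b set \<Rightarrow> ('a \<times> 'b) set set" where
  "rectangles X Y = {A \<times> B | A B. A \<subseteq> X \<and> B \<subseteq> Y \<and> A \<noteq> {} \<and> B \<noteq> {}}"

definition mono_rectangles ::
  "'a set \<Rightarrow> 'b set \<Rightarrow> 'c set \<Rightarrow> ('a \<times> 'b \<times> 'c) set \<Rightarrow> ('a \<times> 'b) set set" where
  "mono_rectangles X Y Z T =
     {R \<in> rectangles X Y. \<exists>z\<in>Z. \<forall>(x, y)\<in>R. (x, y, z) \<in> T}"

text \<open>
  The two parts are disjoint and nonempty, hence distinct: every member of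
  \<open>rectangle_partitions X Y R\<close> has exactly two elements.
\<close>

definition rectangle_partitions ::
  "'a set \<Rightarrow> 'b set \<Rightarrow> ('a \<times> 'b) set \<Rightarrow> ('a \<times> 'b) set set set" where
  "rectangle_partitions X Y R =
     {{A1 \<times> B, A2 \<times> B} | A1 A2 B.
        A1 \<times> B \<in> rectangles X Y \<and> A2 \<times> B \<in> rectangles X Y \<and>
        R = (A1 \<union> A2) \<times> B \<and> A1 \<inter> A2 = {}} \<union>
     {{A \<times> B1, A \<times> B2} | A B1 B2.
        A \<times> B1 \<in> rectangles X Y \<and> A \<times> B2 \<in> rectangles X Y \<and>
        R = A \<times> (B1 \<union> B2) \<and> B1 \<inter> B2 = {}}"

definition rectangle_partition_pairs ::
  "'a set \<Rightarrow> 'b set \<Rightarrow> (('a \<times> 'b) set \<times> ('a \<times> 'b) set set) set" where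
  "rectangle_partition_pairs X Y = Sigma (rectangles X Y) (rectangle_partitions X Y)"

datatype 'r ltree = Lf 'r | Nd 'r "'r ltree" "'r ltree"

primrec root_label :: "'r ltree \<Rightarrow> 'r" where
  "root_label (Lf R) = R"
| "root_label (Nd R l r) = R"

primrec leaf_labels :: "'r ltree \<Rightarrow> 'r set" where
  "leaf_labels (Lf R) = {R}"
| "leaf_labels (Nd R l r) = leaf_labels l \<union> leaf_labels r"

text \<open>
  Siblings carry disjoint nonempty rectangles and children proper subsets of their parent's
  rectangle, so distinct vertices of a partition tree have distinct labels. The set of leaf
  labels is therefore in bijection with the leaves.
\<close>

primrec partition_tree :: "'a set \<Rightarrow> 'b set \<Rightarrow> ('a \<times> 'b) set ltree \<Rightarrow> bool" where
  "partition_tree X Y (Lf R) \<longleftrightarrow> R \<in> rectangles X Y"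
| "partition_tree X Y (Nd R l r) \<longleftrightarrow>
     R \<in> rectangles X Y \<and> {root_label l, root_label r} \<in> rectangle_partitions X Y R \<and>
     partition_tree X Y l \<and> partition_tree X Y r"

definition recursively_partitions :: "'a set \<Rightarrow> 'b set \<Rightarrow> ('a \<times> 'b) set set \<Rightarrow> bool" where
  "recursively_partitions X Y S \<longleftrightarrow>
     S \<subseteq> rectangles X Y \<and> disjoint S \<and> \<Union>S = X \<times> Y \<and>
     (\<exists>t. partition_tree X Y t \<and> root_label t = X \<times> Y \<and> leaf_labels t = S)"

definition protocol_partition_number ::
  "'a set \<Rightarrow> 'b set \<Rightarrow> 'c set \<Rightarrow> ('a \<times> 'b \<times> 'c) set \<Rightarrow> nat" where
  "protocol_partition_number X Y Z T =
     (LEAST n. \<exists>S. S \<subseteq> mono_rectangles X Y Z T \<and> recursively_partitions X Y S \<and> card S = n)"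

definition PN_feasible ::
  "'a set \<Rightarrow> 'b set \<Rightarrow> 'c set \<Rightarrow> ('a \<times> 'b \<times> 'c) set \<Rightarrow>
   (('a \<times> 'b) set \<Rightarrow> nat) \<Rightarrow> (('a \<times> 'b) set \<times> ('a \<times> 'b) set set \<Rightarrow> nat) \<Rightarrow> bool" where
  "PN_feasible X Y Z T x y \<longleftrightarrow>
     x \<in> mono_rectangles X Y Z T \<rightarrow>\<^sub>E UNIV \<and>
     y \<in> rectangle_partition_pairs X Y \<rightarrow>\<^sub>E UNIV \<and>
     (\<forall>c\<in>X \<times> Y. (\<Sum>R | R \<in> mono_rectangles X Y Z T \<and> c \<in> R. x R) = 1) \<and>
     (\<forall>R\<in>rectangles X Y - {X \<times> Y}.
        (\<Sum>V\<in>rectangles X Y. \<Sum>P | P \<in> rectangle_partitions X Y V \<and> R \<in> P. y (V, P)) =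
        (if R \<in> mono_rectangles X Y Z T
         then (\<Sum>P\<in>rectangle_partitions X Y R. y (R, P)) + x R
         else (\<Sum>P\<in>rectangle_partitions X Y R. y (R, P))))"

definition PN_objective ::
  "'a set \<Rightarrow> 'b set \<Rightarrow> 'c set \<Rightarrow> ('a \<times> 'b \<times> 'c) set \<Rightarrow> (('a \<times> 'b) set \<Rightarrow> nat) \<Rightarrow> nat" where
  "PN_objective X Y Z T x = (\<Sum>R\<in>mono_rectangles X Y Z T. x R)"

text \<open>
  A relation rather than a function, so that asserting an optimal value includes that the
  program is feasible and the minimum attained.
\<close>

definition PN_optimal_value ::
  "'a set \<Rightarrow> 'b set \<Rightarrow> 'c set \<Rightarrow> ('a \<times> 'b \<times> 'c) set \<Rightarrow> nat \<Rightarrow> bool" where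
  "PN_optimal_value X Y Z T v \<longleftrightarrow>
     (\<exists>x y. PN_feasible X Y Z T x y \<and> PN_objective X Y Z T x = v) \<and>
     (\<forall>x y. PN_feasible X Y Z T x y \<longrightarrow> v \<le> PN_objective X Y Z T x)"

end

theory Submission
  imports Defs
begin

text \<open>
  A partition tree yields a feasible point by counting its leaves and its inner vertices, since
  the balance equation holds vertex by vertex. Conversely, in a feasible point every rectangle
  that is produced (has a positive left-hand side in the balance equation) is either selected by
  \<open>x\<close> or split further by \<open>y\<close>, and every selected rectangle is traced back to the full matrix.
  Following any positive entries of \<open>y\<close> downwards from the full matrix therefore gives a
  partition tree with selected leaves. These leaves cover the matrix and the selected rectangles
  are pairwise disjoint, so all selected rectangles occur as leaves.
\<close>

section \<open>Rectangles and partition trees\<close>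

lemma finite_rectangles:
  assumes "finite X" "finite Y"
  shows "finite (rectangles X Y)"
  by (rule finite_subset[of _ "Pow (X \<times> Y)"]) (use assms in \<open>auto simp: rectangles_def\<close>)

lemma nonempty_rectangle: "R \<in> rectangles X Y \<Longrightarrow> R \<noteq> {}"
  by (auto simp: rectangles_def)

lemma rectangle_subset: "R \<in> rectangles X Y \<Longrightarrow> R \<subseteq> X \<times> Y"
  by (auto simp: rectangles_def)

lemma mono_rectangles_subset: "mono_rectangles X Y Z T \<subseteq> rectangles X Y"
  by (auto simp: mono_rectangles_def)

lemma rectangle_partition_cases:
  assumes "P \<in> rectangle_partitions X Y R"
  obtains U V where "P = {U, V}" "U \<in> rectangles X Y" "V \<in> rectangles X Y"
    "R = U \<union> V" "U \<inter> V = {}"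
proof -
  have "\<exists>U V. P = {U, V} \<and> U \<in> rectangles X Y \<and> V \<in> rectangles X Y \<and> R = U \<union> V \<and> U \<inter> V = {}"
    using assms unfolding rectangle_partitions_def
  proof (elim UnE CollectE exE conjE)
    fix A1 A2 B
    assume "P = {A1 \<times> B, A2 \<times> B}" "A1 \<times> B \<in> rectangles X Y" "A2 \<times> B \<in> rectangles X Y"
      "R = (A1 \<union> A2) \<times> B" "A1 \<inter> A2 = {}"
    then show ?thesis by (intro exI[of _ "A1 \<times> B"] exI[of _ "A2 \<times> B"]) auto
  next
    fix A B1 B2
    assume "P = {A \<times> B1, A \<times> B2}" "A \<times> B1 \<in> rectangles X Y" "A \<times> B2 \<in> rectangles X Y"
      "R = A \<times> (B1 \<union> B2)" "B1 \<inter> B2 = {}"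
    then show ?thesis by (intro exI[of _ "A \<times> B1"] exI[of _ "A \<times> B2"]) auto
  qed
  then show ?thesis using that by blast
qed

text \<open>Partitions are unordered, so the case rule may return the parts in the opposite order.
  Its parts are nonempty and disjoint, hence distinct, so \<open>U\<close> and \<open>V\<close>
  cannot collapse to one set.\<close>

lemma rectangle_partition_pair:
  assumes "{U, V} \<in> rectangle_partitions X Y R"
  shows "R = U \<union> V" "U \<inter> V = {}" "U \<noteq> V"
proof -
  obtain U' V' where UV: "{U, V} = {U', V'}" "U' \<in> rectangles X Y" "V' \<in> rectangles X Y"
    "R = U' \<union> V'" "U' \<inter> V' = {}"
    using assms by (rule rectangle_partition_cases)
  have "U' \<noteq> V'" using nonempty_rectangle[OF UV(2)] UV(5) by auto
  moreover have "U = U' \<and> V = V' \<or> U = V' \<and> V = U'"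
    using UV(1) by (simp only: doubleton_eq_iff)
  ultimately show "R = U \<union> V" "U \<inter> V = {}" "U \<noteq> V"
    using UV(4,5) by auto
qed

text \<open>Strict because the other part is nonempty and disjoint. This decrease drives the later
  inductions on cardinality.\<close>

lemma rectangle_partition_psubset:
  assumes "P \<in> rectangle_partitions X Y R" "U \<in> P"
  shows "U \<subset> R"
proof -
  obtain V W where VW: "P = {V, W}" "V \<in> rectangles X Y" "W \<in> rectangles X Y"
    "R = V \<union> W" "V \<inter> W = {}"
    using assms(1) by (rule rectangle_partition_cases)
  have "U = V \<or> U = W" using assms(2) VW(1) by simp
  then show ?thesis
    using VW(4,5) nonempty_rectangle[OF VW(2)] nonempty_rectangle[OF VW(3)] by auto
qed

lemma rectangle_partition_rectangle:
  assumes "P \<in> rectangle_partitions X Y R" "U \<in> P"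
  shows "U \<in> rectangles X Y"
  by (rule rectangle_partition_cases[OF assms(1)]) (use assms(2) in auto)

lemma finite_rectangle_partitions:
  assumes "finite X" "finite Y"
  shows "finite (rectangle_partitions X Y R)"
  by (rule finite_subset[of _ "Pow (rectangles X Y)"])
    (auto simp: finite_rectangles assms intro: rectangle_partition_rectangle)

lemma leaf_labels_rectangles: "partition_tree X Y t \<Longrightarrow> leaf_labels t \<subseteq> rectangles X Y"
  by (induction t) auto

lemma Union_leaf_labels: "partition_tree X Y t \<Longrightarrow> \<Union>(leaf_labels t) = root_label t"
proof (induction t)
  case (Nd R l r)
  then show ?case using rectangle_partition_pair(1)[of "root_label l" "root_label r" X Y R] by simp
qed simp

lemma leaf_labels_separated:
  assumes "partition_tree X Y (Nd R l r)"
  shows "\<Union>(leaf_labels l) \<inter> \<Union>(leaf_labels r) = {}"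
proof -
  have "\<Union>(leaf_labels l) = root_label l" "\<Union>(leaf_labels r) = root_label r"
    using assms Union_leaf_labels[of X Y l] Union_leaf_labels[of X Y r] by simp_all
  moreover have "root_label l \<inter> root_label r = {}"
    using assms rectangle_partition_pair(2)[of "root_label l" "root_label r" X Y R] by simp
  ultimately show ?thesis by simp
qed

lemma disjoint_leaf_labels: "partition_tree X Y t \<Longrightarrow> disjoint (leaf_labels t)"
proof (induction t)
  case (Nd R l r)
  then show ?case
    using leaf_labels_separated[OF Nd.prems] by (auto intro!: disjoint_union)
qed simp

lemma recursively_partitions_leaf_labels:
  assumes "partition_tree X Y t" "root_label t = X \<times> Y"
  shows "recursively_partitions X Y (leaf_labels t)"
  using assms leaf_labels_rectangles disjoint_leaf_labels Union_leaf_labels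
  unfolding recursively_partitions_def by metis

text \<open>Common induction step for building trees: \<open>S\<close> is first the set of
  monochromatic rectangles, later the set of rectangles selected by a feasible point.\<close>

lemma partition_tree_join:
  assumes "P \<in> rectangle_partitions X Y R" "R \<in> rectangles X Y"
    and sub: "\<And>U. U \<in> P \<Longrightarrow> \<exists>t. partition_tree X Y t \<and> root_label t = U \<and> leaf_labels t \<subseteq> S"
  shows "\<exists>t. partition_tree X Y t \<and> root_label t = R \<and> leaf_labels t \<subseteq> S"
proof -
  obtain U V where P: "P = {U, V}"
    using assms(1) by (rule rectangle_partition_cases)
  obtain l where l: "partition_tree X Y l" "root_label l = U" "leaf_labels l \<subseteq> S"
    using sub[of U] P by auto
  obtain r where r: "partition_tree X Y r" "root_label r = V" "leaf_labels r \<subseteq> S"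
    using sub[of V] P by auto
  show ?thesis
    by (rule exI[of _ "Nd R l r"]) (use l r assms(1,2) P in simp)
qed

section \<open>Existence of monochromatic partition trees\<close>

lemma rectangle_partition_exists:
  assumes R: "R \<in> rectangles X Y" and "\<And>c. R \<noteq> {c}"
  obtains P where "P \<in> rectangle_partitions X Y R"
proof -
  obtain A B where AB: "R = A \<times> B" "A \<subseteq> X" "B \<subseteq> Y" "A \<noteq> {}" "B \<noteq> {}"
    using R by (auto simp: rectangles_def)
  then obtain a b where ab: "a \<in> A" "b \<in> B" by blast
  have rect: "A' \<times> B' \<in> rectangles X Y" if "A' \<subseteq> A" "B' \<subseteq> B" "A' \<noteq> {}" "B' \<noteq> {}" for A' B'
    unfolding rectangles_def
    by (intro CollectI exI[of _ A'] exI[of _ B']) (use that AB in \<open>simp add: subset_trans\<close>)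
  \<comment> \<open>A side with a second element allows a single row or column to be split
    off.\<close>
  have "A \<noteq> {a} \<or> B \<noteq> {b}" using assms(2)[of "(a, b)"] AB by auto
  then show ?thesis
  proof
    assume "A \<noteq> {a}"
    then have "{{a} \<times> B, (A - {a}) \<times> B} \<in> rectangle_partitions X Y R"
      unfolding rectangle_partitions_def
      by (intro UnI1 CollectI exI[of _ "{a}"] exI[of _ "A - {a}"] exI[of _ B] conjI rect)
        (use ab AB in auto)
    then show ?thesis by (rule that)
  next
    assume "B \<noteq> {b}"
    then have "{A \<times> {b}, A \<times> (B - {b})} \<in> rectangle_partitions X Y R"
      unfolding rectangle_partitions_def
      by (intro UnI2 CollectI exI[of _ "{b}"] exI[of _ "B - {b}"] exI[of _ A] conjI rect)
        (use ab AB in auto)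
    then show ?thesis by (rule that)
  qed
qed

text \<open>Splitting can continue down to single cells, and these are monochromatic since every
  cell has an admissible value in \<open>Z\<close>. This provides a candidate for the minimum
  defining \<open>protocol_partition_number\<close>.\<close>

lemma mono_partition_tree_exists:
  assumes "finite X" "finite Y" "\<forall>x\<in>X. \<forall>y\<in>Y. \<exists>z\<in>Z. (x, y, z) \<in> T"
    and "R \<in> rectangles X Y"
  shows "\<exists>t. partition_tree X Y t \<and> root_label t = R \<and> leaf_labels t \<subseteq> mono_rectangles X Y Z T"
  using assms(4)
proof (induction "card R" arbitrary: R rule: less_induct)
  case less
  have fin: "finite R"
    using finite_subset[OF rectangle_subset[OF less.prems]] assms by simp
  show ?case
  proof (cases "\<exists>c. R = {c}")
    case True
    then obtain a b where "R = {(a, b)}" by auto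
    then have "R \<in> mono_rectangles X Y Z T"
      using assms(3) less.prems rectangle_subset[OF less.prems]
      by (auto simp: mono_rectangles_def)
    then show ?thesis using less.prems by (intro exI[of _ "Lf R"]) auto
  next
    case False
    then obtain P where P: "P \<in> rectangle_partitions X Y R"
      using rectangle_partition_exists[OF less.prems] by blast
    show ?thesis
    proof (rule partition_tree_join[OF P less.prems])
      fix U assume U: "U \<in> P"
      show "\<exists>t. partition_tree X Y t \<and> root_label t = U \<and> leaf_labels t \<subseteq> mono_rectangles X Y Z T"
        using rectangle_partition_psubset[OF P U] rectangle_partition_rectangle[OF P U] fin
        by (intro less.hyps psubset_card_mono)
    qed
  qed
qed

section \<open>From partition trees to feasible points\<close>

text \<open>Counting with multiplicity makes the future \<open>x\<close> and \<open>y\<close>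
  additive over subtrees, so balance follows by structural induction without comparing labels across
  the two subtrees.\<close>

primrec leaf_count :: "'r ltree \<Rightarrow> 'r \<Rightarrow> nat" where
  "leaf_count (Lf R) Q = (if Q = R then 1 else 0)"
| "leaf_count (Nd R l r) Q = leaf_count l Q + leaf_count r Q"

primrec node_count :: "'r ltree \<Rightarrow> 'r \<times> 'r set \<Rightarrow> nat" where
  "node_count (Lf R) q = 0"
| "node_count (Nd R l r) q =
     (if q = (R, {root_label l, root_label r}) then 1 else 0) + node_count l q + node_count r q"

lemma leaf_count_pos_iff: "0 < leaf_count t R \<longleftrightarrow> R \<in> leaf_labels t"
  by (induction t) auto

text \<open>Leaves of sibling subtrees cover disjoint sets of cells, so a nonempty rectangle cannot
  be a leaf label on both sides.\<close>

lemma leaf_count_eq_1: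
  assumes "partition_tree X Y t" "R \<in> leaf_labels t"
  shows "leaf_count t R = 1"
  using assms
proof (induction t)
  case (Nd Q l r)
  have "R \<noteq> {}"
    using leaf_labels_rectangles[OF Nd.prems(1)] Nd.prems(2) nonempty_rectangle by blast
  then have "R \<notin> leaf_labels l \<or> R \<notin> leaf_labels r"
    using leaf_labels_separated[OF Nd.prems(1)] by blast
  then have "leaf_count l R = 0 \<or> leaf_count r R = 0"
    by (metis leaf_count_pos_iff neq0_conv)
  then show ?case using Nd leaf_count_pos_iff[of l R] leaf_count_pos_iff[of r R] by auto
qed simp

lemma leaf_count_eq_indicator:
  assumes "partition_tree X Y t"
  shows "leaf_count t R = (if R \<in> leaf_labels t then 1 else 0)"
  using leaf_count_eq_1[OF assms] leaf_count_pos_iff[of t R] by auto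

text \<open>A vertex labelled \<open>R\<close> is either the root or a part of the split at its
  parent; it is also either an inner vertex or a leaf. The two sides count these vertices in these
  two ways. The root term makes the equation inductive: the split at a new root supplies exactly the
  root terms of the two subtrees.\<close>

lemma partition_tree_balance:
  assumes "finite X" "finite Y" "partition_tree X Y t"
  shows "(\<Sum>V\<in>rectangles X Y. \<Sum>P | P \<in> rectangle_partitions X Y V \<and> R \<in> P. node_count t (V, P))
      + (if R = root_label t then 1 else 0)
    = (\<Sum>P\<in>rectangle_partitions X Y R. node_count t (R, P)) + leaf_count t R"
  using assms(3)
proof (induction t)
  case (Nd Q l r)
  let ?P = "{root_label l, root_label r}"
  have Q: "Q \<in> rectangles X Y" and P: "?P \<in> rectangle_partitions X Y Q"
    using Nd.prems by auto
  \<comment> \<open>The facts \<open>inflow\<close> and \<open>outflow\<close> isolate what the new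
    root adds: its single entry \<open>(Q, ?P)\<close> produces each child once and splits
    \<open>Q\<close> once.\<close>
  have "(\<Sum>V\<in>rectangles X Y. \<Sum>P | P \<in> rectangle_partitions X Y V \<and> R \<in> P.
           if (V, P) = (Q, ?P) then 1 else 0)
      = (\<Sum>q\<in>(SIGMA V:rectangles X Y. {P. P \<in> rectangle_partitions X Y V \<and> R \<in> P}).
           if q = (Q, ?P) then 1 else (0::nat))"
    by (subst sum.Sigma; (rule sum.cong)?;
      simp add: assms finite_rectangles finite_rectangle_partitions split_beta prod_eq_iff)
  also have "\<dots> = (if R \<in> ?P then 1 else 0)"
    by (subst sum.delta[OF finite_SigmaI])
      (use assms Q P in \<open>auto simp: finite_rectangles finite_rectangle_partitions\<close>)
  also have "\<dots> = (if R = root_label l then 1 else 0) + (if R = root_label r then 1 else 0)"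
    using rectangle_partition_pair(3)[OF P] by auto
  finally have inflow: "(\<Sum>V\<in>rectangles X Y. \<Sum>P | P \<in> rectangle_partitions X Y V \<and> R \<in> P.
           if (V, P) = (Q, ?P) then 1 else 0)
      = (if R = root_label l then 1 else 0) + (if R = root_label r then 1 else (0::nat))" .
  have outflow: "(\<Sum>P\<in>rectangle_partitions X Y R. if (R, P) = (Q, ?P) then 1 else 0)
      = (if R = Q then 1 else (0::nat))"
    using P assms by (cases "R = Q") (auto simp: finite_rectangle_partitions sum.delta)
  have "partition_tree X Y l" "partition_tree X Y r" using Nd.prems by auto
  note IH = Nd.IH(1)[OF this(1)] Nd.IH(2)[OF this(2)]
  show ?case
    unfolding node_count.simps leaf_count.simps root_label.simps sum.distrib inflow outflow
    using IH by linarith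
qed auto

lemma sum_indicator_subset:
  assumes "finite M" "S \<subseteq> M"
  shows "(\<Sum>R\<in>M. if R \<in> S then 1 else (0::nat)) = card S"
  using assms by (simp add: sum.If_cases Int_absorb1)

lemma partition_tree_feasible:
  assumes fin: "finite X" "finite Y"
    and t: "partition_tree X Y t" "root_label t = X \<times> Y" "leaf_labels t \<subseteq> mono_rectangles X Y Z T"
  shows "\<exists>x y. PN_feasible X Y Z T x y \<and> PN_objective X Y Z T x = card (leaf_labels t)"
proof -
  let ?M = "mono_rectangles X Y Z T" and ?S = "leaf_labels t"
  have finM: "finite ?M"
    using finite_subset[OF mono_rectangles_subset finite_rectangles[OF fin]] .
  \<comment> \<open>Feasibility asks for extensional functions, so both counts are restricted to the
    index sets of the variables.\<close>
  define x where "x = restrict (leaf_count t) ?M"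
  define y where "y = restrict (node_count t) (rectangle_partition_pairs X Y)"
  have x: "x R = (if R \<in> ?S then 1 else 0)" if "R \<in> ?M" for R
    using that by (simp add: x_def leaf_count_eq_indicator[OF t(1)])
  have y: "y (V, P) = node_count t (V, P)"
    if "V \<in> rectangles X Y" "P \<in> rectangle_partitions X Y V" for V P
    using that by (simp add: y_def rectangle_partition_pairs_def)
  have cover: "(\<Sum>R | R \<in> ?M \<and> c \<in> R. x R) = 1" if c: "c \<in> X \<times> Y" for c
  proof -
    obtain U where U: "U \<in> ?S" "c \<in> U"
      using c Union_leaf_labels[OF t(1)] t(2) by blast
    then have "{R \<in> ?S. c \<in> R} = {U}"
      using disjoint_leaf_labels[OF t(1)] by (auto simp: disjoint_def)
    moreover have "(\<Sum>R | R \<in> ?M \<and> c \<in> R. x R)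
        = (\<Sum>R | R \<in> ?M \<and> c \<in> R. if R \<in> {R \<in> ?S. c \<in> R} then 1 else 0)"
      by (intro sum.cong) (auto simp: x)
    moreover have "\<dots> = card {R \<in> ?S. c \<in> R}"
      using finM t(3) by (intro sum_indicator_subset) auto
    ultimately show ?thesis by simp
  qed
  have balance: "(\<Sum>V\<in>rectangles X Y. \<Sum>P | P \<in> rectangle_partitions X Y V \<and> R \<in> P. y (V, P)) =
      (if R \<in> ?M then (\<Sum>P\<in>rectangle_partitions X Y R. y (R, P)) + x R
       else (\<Sum>P\<in>rectangle_partitions X Y R. y (R, P)))"
    if R: "R \<in> rectangles X Y - {X \<times> Y}" for R
  proof -
    have "(\<Sum>V\<in>rectangles X Y. \<Sum>P | P \<in> rectangle_partitions X Y V \<and> R \<in> P. y (V, P))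
        = (\<Sum>V\<in>rectangles X Y. \<Sum>P | P \<in> rectangle_partitions X Y V \<and> R \<in> P. node_count t (V, P))"
      by (intro sum.cong) (auto simp: y)
    moreover have "(\<Sum>P\<in>rectangle_partitions X Y R. y (R, P))
        = (\<Sum>P\<in>rectangle_partitions X Y R. node_count t (R, P))"
      using R by (intro sum.cong) (auto simp: y)
    \<comment> \<open>All leaves are monochromatic, so the leaf count vanishes off
      \<open>?M\<close>; this matches the case distinction in the constraint.\<close>
    moreover have "leaf_count t R = (if R \<in> ?M then x R else 0)"
      using t(3) by (auto simp: x_def leaf_count_eq_indicator[OF t(1)])
    \<comment> \<open>The root term is zero because \<open>R\<close> is not the full matrix.\<close>
    ultimately show ?thesis
      using partition_tree_balance[OF fin t(1), of R] R t(2) by auto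
  qed
  have "PN_feasible X Y Z T x y"
    unfolding PN_feasible_def using cover balance by (auto simp: x_def y_def)
  moreover have "PN_objective X Y Z T x = card ?S"
    using sum_indicator_subset[OF finM t(3)] by (simp add: PN_objective_def x)
  ultimately show ?thesis by blast
qed

section \<open>From feasible points to partition trees\<close>

lemma feasible_partition:
  assumes fin: "finite X" "finite Y" and ne: "X \<noteq> {}" "Y \<noteq> {}"
    and feas: "PN_feasible X Y Z T x y"
  shows "\<exists>S \<subseteq> mono_rectangles X Y Z T. recursively_partitions X Y S \<and>
    card S = PN_objective X Y Z T x"
proof -
  let ?M = "mono_rectangles X Y Z T"
  have finM: "finite ?M"
    using finite_subset[OF mono_rectangles_subset finite_rectangles[OF fin]] .
  have cover: "(\<Sum>R | R \<in> ?M \<and> c \<in> R. x R) = 1" if "c \<in> X \<times> Y" for c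
    using feas that unfolding PN_feasible_def by blast
  define inflow where
    "inflow R = (\<Sum>V\<in>rectangles X Y. \<Sum>P | P \<in> rectangle_partitions X Y V \<and> R \<in> P. y (V, P))" for R
  have balance: "inflow R =
      (if R \<in> ?M then (\<Sum>P\<in>rectangle_partitions X Y R. y (R, P)) + x R
       else (\<Sum>P\<in>rectangle_partitions X Y R. y (R, P)))"
    if "R \<in> rectangles X Y" "R \<noteq> X \<times> Y" for R
    using feas that unfolding PN_feasible_def inflow_def by blast
  have inflow_pos: "0 < inflow R \<longleftrightarrow>
      (\<exists>V\<in>rectangles X Y. \<exists>P\<in>rectangle_partitions X Y V. R \<in> P \<and> 0 < y (V, P))" for R
    unfolding inflow_def zero_less_iff_neq_zero
    using fin by (auto simp: finite_rectangles finite_rectangle_partitions)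
  define S where "S = {R \<in> ?M. 0 < x R}"
  have finS: "finite S" using finM by (simp add: S_def)
  have SM: "S \<subseteq> ?M" by (auto simp: S_def)
  have S_rect: "R \<in> rectangles X Y" if "R \<in> S" for R
    using that SM mono_rectangles_subset by blast
  have full: "X \<times> Y \<in> rectangles X Y" using ne by (auto simp: rectangles_def)
  \<comment> \<open>Two different selected rectangles sharing a cell would make the cover sum at
    that cell at least 2.\<close>
  have cell_unique: "U = V" if "U \<in> S" "V \<in> S" "c \<in> U" "c \<in> V" for U V c
  proof (rule ccontr)
    assume "U \<noteq> V"
    have "c \<in> X \<times> Y" using that rectangle_subset[OF S_rect] by blast
    then have "x U + x V \<le> 1"
      using sum_mono2[of "{R \<in> ?M. c \<in> R}" "{U, V}" x] cover[of c] finM that \<open>U \<noteq> V\<close>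
      by (auto simp: S_def)
    then show False using that by (auto simp: S_def)
  qed
  have x1: "x R = 1" if R: "R \<in> S" for R
  proof -
    obtain c where c: "c \<in> R" using nonempty_rectangle[OF S_rect[OF R]] by blast
    then have "c \<in> X \<times> Y" using rectangle_subset[OF S_rect[OF R]] by blast
    then have "x R \<le> 1"
      using member_le_sum[of R "{R \<in> ?M. c \<in> R}" x] cover[of c] finM R c by (auto simp: S_def)
    then show ?thesis using R by (auto simp: S_def)
  qed
  have obj: "PN_objective X Y Z T x = card S"
  proof -
    have "PN_objective X Y Z T x = (\<Sum>R\<in>S. x R)"
      unfolding PN_objective_def by (rule sum.mono_neutral_right) (use finM in \<open>auto simp: S_def\<close>)
    then show ?thesis using x1 by simp
  qed
  \<comment> \<open>Positive inflow has to leave again, through \<open>x\<close> or through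
    \<open>y\<close>.\<close>
  have split: "R \<in> S \<or> (\<exists>P\<in>rectangle_partitions X Y R. 0 < y (R, P))"
    if "R \<in> rectangles X Y" "R \<noteq> X \<times> Y" "0 < inflow R" for R
  proof (rule ccontr)
    assume neg: "\<not> ?thesis"
    then have "(\<Sum>P\<in>rectangle_partitions X Y R. y (R, P)) = 0"
      by (auto intro!: sum.neutral)
    then have "inflow R = 0" using balance[OF that(1,2)] neg by (auto simp: S_def split: if_splits)
    then show False using that(3) by simp
  qed
  \<comment> \<open>Conversely, below the full matrix only a produced rectangle can be
    split.\<close>
  have split_inflow: "0 < inflow V"
    if "V \<in> rectangles X Y" "V \<noteq> X \<times> Y" "P \<in> rectangle_partitions X Y V" "0 < y (V, P)" for V P
  proof -
    have "y (V, P) \<le> (\<Sum>P\<in>rectangle_partitions X Y V. y (V, P))"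
      using that fin by (intro member_le_sum) (auto simp: finite_rectangle_partitions)
    then show ?thesis using balance[OF that(1,2)] that(4) by (auto split: if_splits)
  qed
  \<comment> \<open>Parents are strictly larger, so tracing positive entries of \<open>y\<close>
    upwards ends at the full matrix; the induction is on the number of missing cells.\<close>
  have up: "\<exists>P\<in>rectangle_partitions X Y (X \<times> Y). 0 < y (X \<times> Y, P)"
    if "0 < inflow R" for R
    using that
  proof (induction "card (X \<times> Y) - card R" arbitrary: R rule: less_induct)
    case less
    obtain V P where V: "V \<in> rectangles X Y" "P \<in> rectangle_partitions X Y V" "R \<in> P" "0 < y (V, P)"
      using less.prems inflow_pos by blast
    show ?case
    proof (cases "V = X \<times> Y")
      case False
      have sub: "V \<subseteq> X \<times> Y" using V(1) by (rule rectangle_subset)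
      have "card V \<le> card (X \<times> Y)" "card R < card V"
        using fin sub rectangle_partition_psubset[OF V(2,3)]
        by (intro card_mono psubset_card_mono finite_subset[OF sub]; simp)+
      then have "card (X \<times> Y) - card V < card (X \<times> Y) - card R" by simp
      then show ?thesis using less.hyps split_inflow[OF V(1) False V(2,4)] by blast
    qed (use V in auto)
  qed
  \<comment> \<open>The full matrix has no balance equation, so \<open>split\<close> does not apply
    to it. Covering one cell yields a selected rectangle, which is the full matrix or is traced back
    by \<open>up\<close> to a split of it.\<close>
  have root_split: "X \<times> Y \<in> S \<or> (\<exists>P\<in>rectangle_partitions X Y (X \<times> Y). 0 < y (X \<times> Y, P))"
  proof (rule disjCI)
    assume no: "\<not> (\<exists>P\<in>rectangle_partitions X Y (X \<times> Y). 0 < y (X \<times> Y, P))"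
    obtain c where c: "c \<in> X \<times> Y" using ne by blast
    have "\<exists>R. R \<in> ?M \<and> c \<in> R \<and> 0 < x R"
    proof (rule ccontr)
      assume "\<not> ?thesis"
      then have "(\<Sum>R | R \<in> ?M \<and> c \<in> R. x R) = 0" by (intro sum.neutral) auto
      then show False using cover[OF c] by simp
    qed
    then obtain R where R: "R \<in> S" by (auto simp: S_def)
    have "R = X \<times> Y"
    proof (rule ccontr)
      assume "R \<noteq> X \<times> Y"
      then have "0 < inflow R" using balance[OF S_rect[OF R]] R by (auto simp: S_def)
      then show False using up no by blast
    qed
    then show "X \<times> Y \<in> S" using R by simp
  qed
  \<comment> \<open>Any positive entry of \<open>y\<close> may be chosen at each vertex, and the
    descent stops as soon as a selected rectangle is reached.\<close>
  have tree: "\<exists>t. partition_tree X Y t \<and> root_label t = R \<and> leaf_labels t \<subseteq> S"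
    if "R \<in> rectangles X Y" "R \<in> S \<or> (\<exists>P\<in>rectangle_partitions X Y R. 0 < y (R, P))" for R
    using that
  proof (induction "card R" arbitrary: R rule: less_induct)
    case less
    show ?case
    proof (cases "R \<in> S")
      case True
      then show ?thesis using less.prems by (intro exI[of _ "Lf R"]) auto
    next
      case False
      then obtain P where P: "P \<in> rectangle_partitions X Y R" "0 < y (R, P)"
        using less.prems by blast
      show ?thesis
      proof (rule partition_tree_join[OF P(1) less.prems(1)])
        fix U assume U: "U \<in> P"
        have R: "R \<subseteq> X \<times> Y" using less.prems(1) by (rule rectangle_subset)
        have sub: "U \<subset> R" by (rule rectangle_partition_psubset[OF P(1) U])
        have rect: "U \<in> rectangles X Y" by (rule rectangle_partition_rectangle[OF P(1) U])
        have "0 < inflow U" using inflow_pos less.prems(1) P U by blast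
        moreover have "U \<noteq> X \<times> Y" using sub R by blast
        moreover have "card U < card R"
          using sub finite_subset[OF R] fin by (intro psubset_card_mono) auto
        ultimately show "\<exists>t. partition_tree X Y t \<and> root_label t = U \<and> leaf_labels t \<subseteq> S"
          using less.hyps rect split by blast
      qed
    qed
  qed
  then obtain t where t: "partition_tree X Y t" "root_label t = X \<times> Y" "leaf_labels t \<subseteq> S"
    using full root_split by blast
  \<comment> \<open>The leaf containing a cell of \<open>R\<close> is itself selected, hence equals
    \<open>R\<close> by \<open>cell_unique\<close>. So the objective counts exactly the
    leaves.\<close>
  have "S \<subseteq> leaf_labels t"
  proof
    fix R assume R: "R \<in> S"
    obtain c where c: "c \<in> R" using nonempty_rectangle[OF S_rect[OF R]] by blast
    then have "c \<in> \<Union>(leaf_labels t)"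
      using rectangle_subset[OF S_rect[OF R]] Union_leaf_labels[OF t(1)] t(2) by auto
    then show "R \<in> leaf_labels t" using cell_unique[OF R] c t(3) by blast
  qed
  then have "leaf_labels t = S" using t(3) by blast
  then have "recursively_partitions X Y S"
    using recursively_partitions_leaf_labels[OF t(1,2)] by simp
  then show ?thesis using SM obj by auto
qed

section \<open>Equality of the two minima\<close>

theorem theorem3:
  fixes X :: "'a set" and Y :: "'b set" and Z :: "'c set" and T :: "('a \<times> 'b \<times> 'c) set"
  assumes "finite X" and "finite Y" and "finite Z"
    and "T \<subseteq> X \<times> Y \<times> Z" and "T \<noteq> {}"
    and "\<forall>x\<in>X. \<forall>y\<in>Y. \<exists>z\<in>Z. (x, y, z) \<in> T"
  shows "PN_optimal_value X Y Z T (protocol_partition_number X Y Z T)"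
proof -
  let ?Q = "\<lambda>n. \<exists>S. S \<subseteq> mono_rectangles X Y Z T \<and> recursively_partitions X Y S \<and> card S = n"
  have ne: "X \<noteq> {}" "Y \<noteq> {}" using assms(4,5) by auto
  then have "X \<times> Y \<in> rectangles X Y" by (auto simp: rectangles_def)
  then obtain t where "partition_tree X Y t" "root_label t = X \<times> Y"
    "leaf_labels t \<subseteq> mono_rectangles X Y Z T"
    using mono_partition_tree_exists[OF assms(1,2,6)] by blast
  then have "?Q (card (leaf_labels t))" using recursively_partitions_leaf_labels by blast
  \<comment> \<open>Since some size is realised, the \<open>LEAST\<close> is attained, and its
    witness becomes a feasible point.\<close>
  then have "?Q (protocol_partition_number X Y Z T)"
    unfolding protocol_partition_number_def by (rule LeastI)
  then obtain t' where "partition_tree X Y t'" "root_label t' = X \<times> Y"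
    "leaf_labels t' \<subseteq> mono_rectangles X Y Z T"
    "card (leaf_labels t') = protocol_partition_number X Y Z T"
    unfolding recursively_partitions_def by blast
  then have "\<exists>x y. PN_feasible X Y Z T x y \<and>
      PN_objective X Y Z T x = protocol_partition_number X Y Z T"
    using partition_tree_feasible[OF assms(1,2)] by metis
  \<comment> \<open>The objective of a feasible point is itself a size over which the
    \<open>LEAST\<close> ranges.\<close>
  moreover have "protocol_partition_number X Y Z T \<le> PN_objective X Y Z T x"
    if "PN_feasible X Y Z T x y" for x y
    unfolding protocol_partition_number_def
    using feasible_partition[OF assms(1,2) ne that] by (intro Least_le) blast
  ultimately show ?thesis unfolding PN_optimal_value_def by blast
qed

end
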